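(* Let $\mu$ be a positive rational number and $\alpha>-1$. For every positive integer $n$ and every constant $a_0\ne0$, the fractional differential equation (on $x>0$) $$x^\mu\left({}^CD_x^\mu\right)^2y(x)+(\alpha+1-x^\mu)\,{}^CD_x^\mu y(x)+\frac{\Gamma(\mu)}{B(1+\mu(n-1),\mu)}\,y(x)=0$$ has as a solution the polynomial in $x^\mu$ of degree $n$ $$y_{L,m_\mu}(x)=\sum_{\nu=0}^na_\nu x^{\mu\nu},$$ with $a_1=-\frac{a_0}{(\alpha+1)\mu B(1+\mu(n-1),\mu)}$ and, for $2\le\nu\le n$, $$a_\nu=-\frac{a_0}{(\alpha+1)\mu B(1+\mu(n-1),\mu)}\prod_{j=1}^{\nu-1}\left(\frac{B(1+\mu(n-1),\mu)-B(1+\mu(j-1),\mu)}{\frac{B(1+\mu(n-1),\mu)\,B(1+\mu(j-1),\mu)}{B(1+\mu j,\mu)}\left(\alpha+1+\frac{\Gamma(\mu)}{B(1+\mu(j-1),\mu)}\right)}\right).$$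
   Context: $\Gamma$ is the Gamma function and $B(\cdot,\cdot)$ the beta function, $B(a,b)=\Gamma(a)\Gamma(b)/\Gamma(a+b)$. ${}^CD_x^\mu$ is the Caputo fractional derivative with base point $0$: for $x>0$, ${}^CD_x^\mu f(x)=\frac{1}{\Gamma(N-\mu)}\int_0^x\frac{f^{(N)}(\tau)}{(x-\tau)^{\mu+1-N}}\,d\tau$ if $N-1<\mu<N\in\mathbb{N}$, and ${}^CD_x^Nf=\frac{d^N}{dx^N}f$ if $\mu=N\in\mathbb{N}$. $({}^CD_x^\mu)^2$ means ${}^CD_x^\mu$ applied twice. *)

theory Defs
  imports "HOL-Analysis.Analysis"
begin

text \<open>
  The integer \<open>nat \<lceil>\<mu>\<rceil>\<close> is the unique \<open>N\<close> with \<open>N - 1 < \<mu> \<le> N\<close>. Only the values of \<open>f\<close> on the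
  positive half-line enter, so the operator may be iterated regardless of its value at \<open>0\<close>.
  It is meaningful for \<open>\<mu> > 0\<close> and \<open>x > 0\<close>.
\<close>

definition caputo_deriv :: "real \<Rightarrow> (real \<Rightarrow> real) \<Rightarrow> real \<Rightarrow> real" where
  "caputo_deriv \<mu> f x =
    (let N = nat \<lceil>\<mu>\<rceil> in
      if \<mu> = real N then (deriv ^^ N) f x
      else 1 / Gamma (real N - \<mu>) *
        (LBINT \<tau>:{0<..<x}. (deriv ^^ N) f \<tau> / (x - \<tau>) powr (\<mu> + 1 - real N)))"

text \<open>
  \<^const>\<open>deriv\<close> and the Lebesgue integral are total functions; this predicate says that the
  derivatives and the integral in \<^const>\<open>caputo_deriv\<close> actually exist.
\<close>

definition caputo_differentiable :: "real \<Rightarrow> (real \<Rightarrow> real) \<Rightarrow> real \<Rightarrow> bool" where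
  "caputo_differentiable \<mu> f x \<longleftrightarrow>
    (let N = nat \<lceil>\<mu>\<rceil> in
      (\<forall>k<N. \<forall>\<tau>\<in>{0<..x}. (deriv ^^ k) f field_differentiable (at \<tau>)) \<and>
      (\<mu> \<noteq> real N \<longrightarrow>
        set_integrable lborel {0<..<x}
          (\<lambda>\<tau>. (deriv ^^ N) f \<tau> / (x - \<tau>) powr (\<mu> + 1 - real N))))"

end

theory Submission
  imports Defs
begin

text \<open>
  By the Beta integral, the Caputo derivative kills constants and maps \<open>x\<^bsup>\<mu>k\<^esup>\<close> (\<open>k \<ge> 1\<close>) to
  \<open>e\<^sub>k x\<^bsup>\<mu>(k-1)\<^esup>\<close> with \<open>e\<^sub>k = \<Gamma>(\<mu>k + 1) / \<Gamma>(\<mu>(k-1) + 1) = \<Gamma>(\<mu>) / B(1 + \<mu>(k-1), \<mu>)\<close>.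
  With \<open>e\<^sub>0 = 0\<close>, comparing coefficients of \<open>x\<^bsup>\<mu>k\<^esup>\<close> turns the equation into the two-term recurrence
  \<open>a\<^bsub>k+1\<^esub> e\<^bsub>k+1\<^esub> (e\<^sub>k + \<alpha> + 1) = (e\<^sub>k - e\<^sub>n) a\<^sub>k\<close>, which the given product solves and which stops
  at \<open>k = n\<close>. Since the digamma function increases, \<open>e\<^sub>k\<close> is strictly increasing, so no earlier
  coefficient vanishes and the degree is exactly \<open>n\<close>.
\<close>

section \<open>The Beta integral on a bounded interval\<close>

text \<open>This is the Beta integral over the unit interval after the substitution
  \<open>t / x\<close>. The Bochner form carries integrability and value together; both are needed
  later.\<close>

lemma has_bochner_integral_Beta:
  fixes a b x :: real
  assumes "a > 0" "b > 0" "x > 0"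
  shows "has_bochner_integral lborel
    (\<lambda>t. indicator {0<..<x} t * (t powr (a - 1) * (x - t) powr (b - 1)))
    (x powr (a + b - 1) * Beta a b)"
proof -
  have I: "((\<lambda>t. t powr (a - 1) * (1 - t) powr (b - 1)) has_integral Beta a b) {0<..<1}"
    using has_integral_Beta_real[OF assms(1,2)] by (simp add: has_integral_Icc_iff_Ioo)
  have B: "Beta a b \<ge> 0"
    using has_integral_nonneg[OF I] by simp
  \<comment> \<open>\<open>I\<close> is a gauge integral. As the integrand is nonnegative, the
    nonnegative Lebesgue integral turns it into a Bochner integral.\<close>
  have unit: "has_bochner_integral lborel
      (\<lambda>t. indicator {0<..<1} t * (t powr (a - 1) * (1 - t) powr (b - 1))) (Beta a b)"
    using nn_integral_has_integral_lebesgue[OF _ I] B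
    by (intro has_bochner_integral_nn_integral) auto
  have "has_bochner_integral lborel
      (\<lambda>t. indicator {0<..<1} (t / x) * ((t / x) powr (a - 1) * (1 - t / x) powr (b - 1))) (x * Beta a b)"
    using lborel_has_bochner_integral_real_affine_iff[of "1 / x"
        "\<lambda>t. indicator {0<..<1} t * (t powr (a - 1) * (1 - t) powr (b - 1))" "Beta a b" 0] unit assms
    by simp
  \<comment> \<open>The new factor cancels the powers of \<open>x\<close> in the two rescaled
    factors; the single \<open>x\<close> left over comes from the change of variable.\<close>
  then have "has_bochner_integral lborel
      (\<lambda>t. x powr (a + b - 2) * (indicator {0<..<1} (t / x) *
        ((t / x) powr (a - 1) * (1 - t / x) powr (b - 1)))) (x powr (a + b - 2) * (x * Beta a b))"
    by (rule has_bochner_integral_mult_right)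
  moreover have "x powr (a + b - 2) * (indicator {0<..<1} (t / x) *
        ((t / x) powr (a - 1) * (1 - t / x) powr (b - 1))) =
      indicator {0<..<x} t * (t powr (a - 1) * (x - t) powr (b - 1))" for t
  proof (cases "0 < t \<and> t < x")
    case True
    have "1 - t / x = (x - t) / x"
      using assms by (simp add: field_simps)
    moreover have "x powr (a + b - 2) = x powr (a - 1) * x powr (b - 1)"
      by (simp add: powr_add[symmetric])
    ultimately show ?thesis
      using True assms by (simp add: powr_divide field_simps)
  qed (use assms in \<open>auto simp: indicator_def field_simps\<close>)
  moreover have "x powr (a + b - 2) * (x * Beta a b) = x powr (a + b - 1) * Beta a b"
    using powr_mult_base[of x "a + b - 2"] assms by (simp add: algebra_simps)
  ultimately show ?thesis by simp
qed

section \<open>Iterated derivatives of sums of powers\<close>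

text \<open>The Pochhammer symbol here is the falling factorial
  \<open>p (p - 1) ... (p - k + 1)\<close>. Only values on the positive half-line are assumed, so
  the result also applies to a Caputo derivative, which is known only there.\<close>

lemma deriv_iter_sum_powr:
  fixes f :: "real \<Rightarrow> real"
  assumes f: "\<And>x. x > 0 \<Longrightarrow> f x = (\<Sum>i\<in>I. c i * x powr p i)" and "x > 0"
  shows "(deriv ^^ k) f x = (\<Sum>i\<in>I. c i * pochhammer (p i + 1 - real k) k * x powr (p i - real k))"
    and "(deriv ^^ k) f field_differentiable (at x)"
proof -
  have *: "(g has_real_derivative
        (\<Sum>i\<in>I. c i * pochhammer (p i + 1 - real (Suc k)) (Suc k) * x powr (p i - real (Suc k)))) (at x)"
    if g: "\<And>x. x > 0 \<Longrightarrow> g x = (\<Sum>i\<in>I. c i * pochhammer (p i + 1 - real k) k * x powr (p i - real k))"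
      and x: "x > 0" for g :: "real \<Rightarrow> real" and k x
  proof -
    have "((\<lambda>x. \<Sum>i\<in>I. c i * pochhammer (p i + 1 - real k) k * x powr (p i - real k)) has_real_derivative
        (\<Sum>i\<in>I. c i * pochhammer (p i + 1 - real k) k * ((p i - real k) * x powr (p i - real k - 1)))) (at x)"
      using x by (intro DERIV_sum DERIV_cmult has_real_derivative_powr)
    \<comment> \<open>\<open>pochhammer_rec\<close> splits off the lowest factor
      \<open>p i - real k\<close>, the one produced by the new differentiation.\<close>
    also have "(\<Sum>i\<in>I. c i * pochhammer (p i + 1 - real k) k * ((p i - real k) * x powr (p i - real k - 1))) =
        (\<Sum>i\<in>I. c i * pochhammer (p i + 1 - real (Suc k)) (Suc k) * x powr (p i - real (Suc k)))"
      by (intro sum.cong) (auto simp: pochhammer_rec algebra_simps)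
    finally show ?thesis
      by (rule has_field_derivative_transform_within_open[of _ _ _ "{0<..}"]) (use x g in auto)
  qed
  have eq: "(deriv ^^ k) f x = (\<Sum>i\<in>I. c i * pochhammer (p i + 1 - real k) k * x powr (p i - real k))"
    if "x > 0" for k x
    using that
  proof (induction k arbitrary: x)
    case 0
    then show ?case by (simp add: f)
  next
    case (Suc k)
    have "((deriv ^^ k) f has_real_derivative
        (\<Sum>i\<in>I. c i * pochhammer (p i + 1 - real (Suc k)) (Suc k) * x powr (p i - real (Suc k)))) (at x)"
      using Suc by (intro *) auto
    then show ?case
      by (simp only: funpow.simps o_apply DERIV_imp_deriv)
  qed
  show "(deriv ^^ k) f x = (\<Sum>i\<in>I. c i * pochhammer (p i + 1 - real k) k * x powr (p i - real k))"
    using eq assms(2) .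
  show "(deriv ^^ k) f field_differentiable (at x)"
    using *[of "(deriv ^^ k) f" k x] eq assms(2) by (auto simp: field_differentiable_def)
qed

section \<open>Monotonicity of Gamma quotients\<close>

text \<open>The logarithm of the quotient has derivative
  \<open>Digamma (u + \<mu>) - Digamma u\<close>, which is positive because digamma is strictly
  increasing on the positive reals.\<close>

lemma strict_mono_Gamma_quotient:
  fixes s t \<mu> :: real
  assumes "\<mu> > 0" "0 < s" "s < t"
  shows "Gamma (s + \<mu>) / Gamma s < Gamma (t + \<mu>) / Gamma t"
proof -
  have "ln_Gamma (s + \<mu>) - ln_Gamma s < ln_Gamma (t + \<mu>) - ln_Gamma t"
  proof (rule DERIV_pos_imp_increasing[OF \<open>s < t\<close>])
    fix u assume "s \<le> u" "u \<le> t"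
    then have "u > 0" using assms by simp
    then have "((\<lambda>u. ln_Gamma (u + \<mu>) - ln_Gamma u) has_real_derivative
        Digamma (u + \<mu>) - Digamma u) (at u)"
      using assms by (auto intro!: derivative_eq_intros)
    moreover have "Digamma (u + \<mu>) - Digamma u > 0"
      using Digamma_real_strict_mono[of u "u + \<mu>"] \<open>u > 0\<close> assms by simp
    ultimately show "\<exists>d. ((\<lambda>u. ln_Gamma (u + \<mu>) - ln_Gamma u) has_real_derivative d) (at u) \<and> d > 0"
      by blast
  qed
  then have "exp (ln_Gamma (s + \<mu>) - ln_Gamma s) < exp (ln_Gamma (t + \<mu>) - ln_Gamma t)"
    by simp
  then show ?thesis
    using assms by (simp add: exp_diff Gamma_real_pos_exp)
qed


section \<open>The Caputo derivative of a sum of powers\<close>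

text \<open>The bounds on \<open>p\<close> and \<open>\<mu>\<close> say that both Beta parameters
  are positive, which makes the singularities at \<open>0\<close> and at \<open>x\<close>
  integrable.\<close>

lemma has_bochner_integral_powr_kernel:
  fixes p \<mu> \<nu> x :: real
  assumes "p > \<nu> - 1" "\<mu> < \<nu>" "x > 0"
  shows "has_bochner_integral lborel
    (\<lambda>t. indicator {0<..<x} t * (t powr (p - \<nu>) / (x - t) powr (\<mu> + 1 - \<nu>)))
    (x powr (p - \<mu>) * Beta (p + 1 - \<nu>) (\<nu> - \<mu>))"
proof -
  have "t powr (p - \<nu>) / (x - t) powr (\<mu> + 1 - \<nu>) =
      t powr (p + 1 - \<nu> - 1) * (x - t) powr (\<nu> - \<mu> - 1)" for t
    using powr_minus_divide[of "x - t" "\<mu> + 1 - \<nu>"] by (simp add: algebra_simps)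
  then show ?thesis
    using has_bochner_integral_Beta[of "p + 1 - \<nu>" "\<nu> - \<mu>" x] assms by simp
qed

lemma pochhammer_falling_Gamma:
  fixes p :: real
  assumes "p > real k - 1"
  shows "pochhammer (p + 1 - real k) k = Gamma (p + 1) / Gamma (p + 1 - real k)"
proof -
  have "p + 1 - real k \<notin> \<int>\<^sub>\<le>\<^sub>0"
    using assms by (auto elim!: nonpos_Ints_cases)
  then show ?thesis
    by (simp add: pochhammer_Gamma)
qed

text \<open>A constant term is kept apart because its derivative is zero. For any other exponent,
  exceeding \<open>N - 1\<close> makes the integral of the \<open>N\<close>-th derivative against
  the kernel converge at \<open>0\<close>.\<close>

lemma caputo_sum_powr:
  fixes f :: "real \<Rightarrow> real"
  assumes "\<mu> > 0" and f: "\<And>x. x > 0 \<Longrightarrow> f x = (\<Sum>i\<in>I. c i * x powr p i)"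
    and p: "\<And>i. i \<in> I \<Longrightarrow> p i = 0 \<or> p i > real (nat \<lceil>\<mu>\<rceil>) - 1" and x: "x > 0"
  shows "caputo_differentiable \<mu> f x" (is ?diff)
    and "caputo_deriv \<mu> f x = (\<Sum>i\<in>I. c i *
      (if p i = 0 then 0 else Gamma (p i + 1) / Gamma (p i + 1 - \<mu>)) * x powr (p i - \<mu>))" (is ?eq)
proof -
  define N where "N = nat \<lceil>\<mu>\<rceil>"
  have N: "N \<ge> 1" "\<mu> \<le> real N"
    using \<open>\<mu> > 0\<close> unfolding N_def by linarith+
  define q where "q i = pochhammer (p i + 1 - real N) N" for i
  \<comment> \<open>Index \<open>N - 1\<close>, available since \<open>N \<ge> 1\<close>, gives the
    vanishing factor \<open>1 - N + (N - 1)\<close>.\<close>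
  have q0: "q i = 0" if "p i = 0" for i
    unfolding q_def pochhammer_eq_0_iff using that N by (intro exI[of _ "N - 1"]) auto
  have q1: "q i = Gamma (p i + 1) / Gamma (p i + 1 - real N)" if "i \<in> I" "p i \<noteq> 0" for i
    unfolding q_def using p[of i] that by (intro pochhammer_falling_Gamma) (auto simp: N_def)
  have dN: "(deriv ^^ N) f t = (\<Sum>i\<in>I. c i * q i * t powr (p i - real N))" if "t > 0" for t
    unfolding q_def by (rule deriv_iter_sum_powr(1)[OF f that])
  have diff: "(deriv ^^ k) f field_differentiable (at t)" if "t > 0" for k t
    by (rule deriv_iter_sum_powr(2)[OF f that])
  show ?diff ?eq
  proof (atomize (full), cases "\<mu> = real N")
    case True
    have "c i * q i = c i * (if p i = 0 then 0 else Gamma (p i + 1) / Gamma (p i + 1 - \<mu>))"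
      if "i \<in> I" for i
      using q0 q1 that True by auto
    then have "(deriv ^^ N) f x = (\<Sum>i\<in>I. c i *
        (if p i = 0 then 0 else Gamma (p i + 1) / Gamma (p i + 1 - \<mu>)) * x powr (p i - \<mu>))"
      unfolding dN[OF x] using True by (intro sum.cong) auto
    then show "?diff \<and> ?eq"
      unfolding caputo_differentiable_def caputo_deriv_def Let_def N_def[symmetric]
      using True diff by auto
  next
    case False
    with N have less: "\<mu> < real N" by simp
    define J where "J i = x powr (p i - \<mu>) * Beta (p i + 1 - real N) (real N - \<mu>)" for i
    have term_int: "has_bochner_integral lborel (\<lambda>t. c i * q i *
        (indicator {0<..<x} t * (t powr (p i - real N) / (x - t) powr (\<mu> + 1 - real N))))
        (c i * q i * J i)" if "i \<in> I" for i
    proof (cases "p i = 0")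
      case False
      then show ?thesis
        using p[OF that] less x unfolding J_def
        by (intro has_bochner_integral_mult_right has_bochner_integral_powr_kernel)
          (auto simp: N_def)
    qed (simp add: q0 has_bochner_integral_zero)
    have "has_bochner_integral lborel (\<lambda>t. \<Sum>i\<in>I. c i * q i *
        (indicator {0<..<x} t * (t powr (p i - real N) / (x - t) powr (\<mu> + 1 - real N))))
        (\<Sum>i\<in>I. c i * q i * J i)"
      using term_int by (intro has_bochner_integral_sum)
    \<comment> \<open>Both sides vanish outside \<open>{0<..<x}\<close>, so \<open>dN\<close> is
      used only for positive \<open>t\<close>.\<close>
    also have "(\<lambda>t. \<Sum>i\<in>I. c i * q i *
        (indicator {0<..<x} t * (t powr (p i - real N) / (x - t) powr (\<mu> + 1 - real N)))) =
        (\<lambda>t. indicator {0<..<x} t *\<^sub>R ((deriv ^^ N) f t / (x - t) powr (\<mu> + 1 - real N)))"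
      by (auto simp: fun_eq_iff indicator_def dN sum_divide_distrib)
    finally have int: "has_bochner_integral lborel
        (\<lambda>t. indicator {0<..<x} t *\<^sub>R ((deriv ^^ N) f t / (x - t) powr (\<mu> + 1 - real N)))
        (\<Sum>i\<in>I. c i * q i * J i)" .
    \<comment> \<open>The two Beta parameters add up to \<open>p i + 1 - \<mu>\<close>. Of the Gamma
      values in its numerator, one cancels against \<open>q i\<close>, the other against the
      prefactor.\<close>
    have "1 / Gamma (real N - \<mu>) * (c i * q i * J i) = c i *
        (if p i = 0 then 0 else Gamma (p i + 1) / Gamma (p i + 1 - \<mu>)) * x powr (p i - \<mu>)"
      if "i \<in> I" for i
    proof (cases "p i = 0")
      case False
      then have "p i + 1 - real N > 0" "real N - \<mu> > 0"
        using p[OF that] less by (auto simp: N_def)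
      then have "Gamma (p i + 1 - real N) \<noteq> 0" "Gamma (real N - \<mu>) \<noteq> 0"
        using Gamma_real_pos by (metis less_irrefl)+
      then show ?thesis
        using False by (simp add: q1[OF that False] J_def Beta_def add_diff_eq)
    qed (simp add: q0)
    then have "1 / Gamma (real N - \<mu>) * (\<Sum>i\<in>I. c i * q i * J i) = (\<Sum>i\<in>I. c i *
        (if p i = 0 then 0 else Gamma (p i + 1) / Gamma (p i + 1 - \<mu>)) * x powr (p i - \<mu>))"
      unfolding sum_distrib_left by (intro sum.cong) auto
    then show "?diff \<and> ?eq"
      using int False diff
      unfolding caputo_differentiable_def caputo_deriv_def Let_def N_def[symmetric]
        set_integrable_def set_lebesgue_integral_def has_bochner_integral_iff
      by auto
  qed
qed

section \<open>The factors produced by Caputo differentiation\<close>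

text \<open>
  The numbers \<open>e\<^sub>k\<close>. The quotient of Gamma values is in general not \<open>0\<close> at \<open>k = 0\<close>, although
  the derivative of a constant vanishes.
\<close>

definition caputo_factor :: "real \<Rightarrow> nat \<Rightarrow> real" where
  "caputo_factor \<mu> k = (if k = 0 then 0 else Gamma (\<mu> * real k + 1) / Gamma (\<mu> * real k + 1 - \<mu>))"

lemma caputo_factor_0 [simp]: "caputo_factor \<mu> 0 = 0"
  by (simp add: caputo_factor_def)

lemma caputo_factor_1: "\<mu> > 0 \<Longrightarrow> caputo_factor \<mu> 1 = \<mu> * Gamma \<mu>"
  using Gamma_plus1[of \<mu>] nonpos_Ints_nonpos[of \<mu>] by (auto simp: caputo_factor_def add.commute)

lemma caputo_factor_pos:
  assumes "\<mu> > 0" "k \<ge> 1"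
  shows "caputo_factor \<mu> k > 0"
proof -
  have "\<mu> \<le> \<mu> * real k" using assms by simp
  then have "\<mu> * real k + 1 - \<mu> > 0" by simp
  then show ?thesis
    using assms by (simp add: caputo_factor_def add_pos_pos)
qed

text \<open>For \<open>j \<ge> 1\<close> this compares Gamma quotients at
  \<open>\<mu> * real j + 1 - \<mu>\<close> and its analogue for \<open>k\<close>. At
  \<open>j = 0\<close>, where the factor is set to \<open>0\<close>, positivity suffices.\<close>

lemma caputo_factor_strict_mono:
  assumes "\<mu> > 0" "j < k"
  shows "caputo_factor \<mu> j < caputo_factor \<mu> k"
proof (cases "j = 0")
  case True
  then show ?thesis using caputo_factor_pos[of \<mu> k] assms by simp
next
  case False
  have "\<mu> \<le> \<mu> * real j" using False assms by simp
  then have "\<mu> * real j + 1 - \<mu> > 0" by simp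
  then show ?thesis
    using strict_mono_Gamma_quotient[of \<mu> "\<mu> * real j + 1 - \<mu>" "\<mu> * real k + 1 - \<mu>"] False assms
    by (simp add: caputo_factor_def)
qed

lemma Beta_caputo_factor:
  assumes "\<mu> > 0" "k \<ge> 1"
  shows "Beta (1 + \<mu> * (real k - 1)) \<mu> = Gamma \<mu> / caputo_factor \<mu> k"
  using assms by (simp add: Beta_def caputo_factor_def algebra_simps)

text \<open>Each nonzero exponent is at least \<open>\<mu>\<close>, hence above
  \<open>N - 1\<close>. The derivative again has multiples of \<open>\<mu>\<close> as exponents, so
  the lemma can be applied to its own result.\<close>

lemma caputo_sum_powr_multiples:
  fixes f :: "real \<Rightarrow> real"
  assumes "\<mu> > 0" and f: "\<And>x. x > 0 \<Longrightarrow> f x = (\<Sum>k<m. c k * x powr (\<mu> * real k))" and "x > 0"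
  shows "caputo_differentiable \<mu> f x"
    and "caputo_deriv \<mu> f x = (\<Sum>k<m - 1. c (Suc k) * caputo_factor \<mu> (Suc k) * x powr (\<mu> * real k))"
proof -
  have exponent: "\<mu> * real k = 0 \<or> \<mu> * real k > real (nat \<lceil>\<mu>\<rceil>) - 1" for k
  proof (cases "k = 0")
    case False
    then have "\<mu> \<le> \<mu> * real k"
      using \<open>\<mu> > 0\<close> by simp
    then show ?thesis using \<open>\<mu> > 0\<close> by linarith
  qed simp
  show "caputo_differentiable \<mu> f x"
    by (rule caputo_sum_powr(1)[OF assms(1) f exponent assms(3)])
  have "caputo_deriv \<mu> f x = (\<Sum>k<m. c k *
      (if \<mu> * real k = 0 then 0 else Gamma (\<mu> * real k + 1) / Gamma (\<mu> * real k + 1 - \<mu>)) *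
        x powr (\<mu> * real k - \<mu>))"
    by (rule caputo_sum_powr(2)[OF assms(1) f exponent assms(3)])
  also have "\<dots> = (\<Sum>k<m. c k * caputo_factor \<mu> k * x powr (\<mu> * real k - \<mu>))"
    using \<open>\<mu> > 0\<close> by (intro sum.cong) (auto simp: caputo_factor_def)
  \<comment> \<open>The term \<open>k = 0\<close> drops out because its factor is \<open>0\<close>,
    and the others shift by one. The case split covers the truncated \<open>m - 1\<close> at
    \<open>m = 0\<close>.\<close>
  also have "\<dots> = (\<Sum>k<m - 1. c (Suc k) * caputo_factor \<mu> (Suc k) * x powr (\<mu> * real k))"
    by (cases m) (auto simp: sum.lessThan_Suc_shift algebra_simps simp del: sum.lessThan_Suc)
  finally show "caputo_deriv \<mu> f x =
      (\<Sum>k<m - 1. c (Suc k) * caputo_factor \<mu> (Suc k) * x powr (\<mu> * real k))" .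
qed

section \<open>The recurrence for the coefficients\<close>

lemma coefficient_recurrence:
  fixes a :: "nat \<Rightarrow> real"
  assumes "\<mu> > 0" and "\<alpha> > -1"
    and a1: "a 1 = - (a 0 / ((\<alpha> + 1) * \<mu> * Beta (1 + \<mu> * (real n - 1)) \<mu>))"
    and a: "\<And>\<nu>. 2 \<le> \<nu> \<Longrightarrow> \<nu> \<le> n \<Longrightarrow>
      a \<nu> = - (a 0 / ((\<alpha> + 1) * \<mu> * Beta (1 + \<mu> * (real n - 1)) \<mu>)) *
        (\<Prod>j=1..\<nu>-1.
          (Beta (1 + \<mu> * (real n - 1)) \<mu> - Beta (1 + \<mu> * (real j - 1)) \<mu>) /
          (Beta (1 + \<mu> * (real n - 1)) \<mu> * Beta (1 + \<mu> * (real j - 1)) \<mu> / Beta (1 + \<mu> * real j) \<mu> *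
            (\<alpha> + 1 + Gamma \<mu> / Beta (1 + \<mu> * (real j - 1)) \<mu>)))"
    and "k < n"
  shows "a (Suc k) * caputo_factor \<mu> (Suc k) * (caputo_factor \<mu> k + \<alpha> + 1) =
    (caputo_factor \<mu> k - caputo_factor \<mu> n) * a k"
proof -
  let ?e = "caputo_factor \<mu>"
  \<comment> \<open>This is the ratio \<open>a (Suc j) / a j\<close> that the recurrence
    demands.\<close>
  define r where "r j = (?e j - ?e n) / (?e (Suc j) * (\<alpha> + 1 + ?e j))" for j
  have G: "Gamma \<mu> \<noteq> 0" using Gamma_real_pos[OF \<open>\<mu> > 0\<close>] by linarith
  have en: "?e n > 0" using caputo_factor_pos assms by simp
  have factor: "(Beta (1 + \<mu> * (real n - 1)) \<mu> - Beta (1 + \<mu> * (real j - 1)) \<mu>) /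
      (Beta (1 + \<mu> * (real n - 1)) \<mu> * Beta (1 + \<mu> * (real j - 1)) \<mu> / Beta (1 + \<mu> * real j) \<mu> *
      (\<alpha> + 1 + Gamma \<mu> / Beta (1 + \<mu> * (real j - 1)) \<mu>)) = r j" if "j \<ge> 1" for j
  proof -
    have pos: "?e j > 0" "?e (Suc j) > 0"
      using caputo_factor_pos[OF \<open>\<mu> > 0\<close>] that by simp_all
    have s: "\<alpha> + 1 + ?e j > 0" using pos \<open>\<alpha> > -1\<close> by simp
    have Suc_eq: "Beta (1 + \<mu> * real j) \<mu> = Gamma \<mu> / ?e (Suc j)"
      using Beta_caputo_factor[of \<mu> "Suc j"] \<open>\<mu> > 0\<close> by simp
    have n_eq: "Beta (1 + \<mu> * (real n - 1)) \<mu> = Gamma \<mu> / ?e n"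
      using Beta_caputo_factor[of \<mu> n] assms by simp
    have j_eq: "Beta (1 + \<mu> * (real j - 1)) \<mu> = Gamma \<mu> / ?e j"
      using Beta_caputo_factor[of \<mu> j] that \<open>\<mu> > 0\<close> by simp
    \<comment> \<open>The difference and the quotient of Beta values share the factor
      \<open>Gamma \<mu> / (?e n * ?e j)\<close>; cancelling it leaves \<open>r j\<close>.\<close>
    have "Gamma \<mu> / (Gamma \<mu> / ?e j) = ?e j" using G by simp
    moreover have "Gamma \<mu> / ?e n * (Gamma \<mu> / ?e j) / (Gamma \<mu> / ?e (Suc j)) =
        Gamma \<mu> * ?e (Suc j) / (?e n * ?e j)"
      using G pos en by (simp add: field_simps)
    moreover have "Gamma \<mu> / ?e n - Gamma \<mu> / ?e j = Gamma \<mu> * (?e j - ?e n) / (?e n * ?e j)"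
      using pos en by (simp add: field_simps)
    ultimately show ?thesis
      unfolding Suc_eq n_eq j_eq r_def using G pos en s by simp
  qed
  define A where "A = - (a 0 / ((\<alpha> + 1) * \<mu> * Beta (1 + \<mu> * (real n - 1)) \<mu>))"
  \<comment> \<open>At \<open>\<nu> = 1\<close> the product is empty, so one formula also covers
    \<open>a 1\<close>.\<close>
  have prod: "a \<nu> = A * (\<Prod>j=1..\<nu>-1. r j)" if "1 \<le> \<nu>" "\<nu> \<le> n" for \<nu>
  proof (cases "\<nu> = 1")
    case True
    then show ?thesis by (simp add: a1[unfolded One_nat_def] A_def)
  next
    case False
    then have "2 \<le> \<nu>" using that by simp
    then show ?thesis
      unfolding a[OF \<open>2 \<le> \<nu>\<close> \<open>\<nu> \<le> n\<close>] A_def[symmetric]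
      by (intro arg_cong[of _ _ "\<lambda>z. A * z"] prod.cong refl factor) auto
  qed
  show ?thesis
  proof (cases "k = 0")
    case True
    \<comment> \<open>The prescribed \<open>a 1\<close> settles this case, since
      \<open>?e 0 = 0\<close> and \<open>?e 1 = \<mu> * Gamma \<mu>\<close>.\<close>
    have "(\<alpha> + 1) * \<mu> * (Gamma \<mu> / ?e n) \<noteq> 0"
      using G en \<open>\<mu> > 0\<close> \<open>\<alpha> > -1\<close> by simp
    moreover have "a 1 = - (a 0 / ((\<alpha> + 1) * \<mu> * (Gamma \<mu> / ?e n)))"
      using a1 Beta_caputo_factor[of \<mu> n] \<open>\<mu> > 0\<close> \<open>k < n\<close> by simp
    ultimately have "a 1 * ((\<alpha> + 1) * \<mu> * (Gamma \<mu> / ?e n)) = - a 0"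
      by (simp only: minus_mult_left[symmetric] nonzero_eq_divide_eq[symmetric]) simp
    then show ?thesis
      using True caputo_factor_1[OF \<open>\<mu> > 0\<close>] en by (simp add: field_simps)
  next
    case False
    then have "{1..k} = insert k {1..k - 1}" by auto
    then have "a (Suc k) = a k * r k"
      using False prod[of k] prod[of "Suc k"] \<open>k < n\<close> by (simp add: mult_ac)
    moreover have "\<alpha> + 1 + ?e k > 0" "?e (Suc k) > 0"
      using caputo_factor_pos[OF \<open>\<mu> > 0\<close>, of k] caputo_factor_pos[OF \<open>\<mu> > 0\<close>, of "Suc k"]
        False \<open>\<alpha> > -1\<close> by auto
    ultimately have "a (Suc k) * (?e (Suc k) * (\<alpha> + 1 + ?e k)) = a k * (?e k - ?e n)"
      by (simp add: r_def)
    then show ?thesis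
      by (simp add: algebra_simps)
  qed
qed

section \<open>The degree and the differential equation\<close>

theorem corollary1:
  fixes \<mu> \<alpha> :: real and n :: nat and a :: "nat \<Rightarrow> real" and y :: "real \<Rightarrow> real"
  assumes "\<mu> \<in> \<rat>" and "\<mu> > 0" and "\<alpha> > -1" and "n \<ge> 1" and "a 0 \<noteq> 0"
    and "a 1 = - (a 0 / ((\<alpha> + 1) * \<mu> * Beta (1 + \<mu> * (real n - 1)) \<mu>))"
    and "\<And>\<nu>. 2 \<le> \<nu> \<Longrightarrow> \<nu> \<le> n \<Longrightarrow>
      a \<nu> = - (a 0 / ((\<alpha> + 1) * \<mu> * Beta (1 + \<mu> * (real n - 1)) \<mu>)) *
        (\<Prod>j=1..\<nu>-1.
          (Beta (1 + \<mu> * (real n - 1)) \<mu> - Beta (1 + \<mu> * (real j - 1)) \<mu>) /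
          (Beta (1 + \<mu> * (real n - 1)) \<mu> * Beta (1 + \<mu> * (real j - 1)) \<mu> / Beta (1 + \<mu> * real j) \<mu> *
            (\<alpha> + 1 + Gamma \<mu> / Beta (1 + \<mu> * (real j - 1)) \<mu>)))"
    and "\<And>x. x > 0 \<Longrightarrow> y x = (\<Sum>\<nu>=0..n. a \<nu> * x powr (\<mu> * real \<nu>))"
  shows "(\<exists>p :: real poly. degree p = n \<and> (\<forall>x>0. y x = poly p (x powr \<mu>))) \<and>
    (\<forall>x>0. caputo_differentiable \<mu> y x \<and> caputo_differentiable \<mu> (caputo_deriv \<mu> y) x \<and>
      x powr \<mu> * (caputo_deriv \<mu> ^^ 2) y x + (\<alpha> + 1 - x powr \<mu>) * caputo_deriv \<mu> y x
        + Gamma \<mu> / Beta (1 + \<mu> * (real n - 1)) \<mu> * y x = 0)"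
proof (intro conjI allI impI)
  let ?e = "caputo_factor \<mu>"
  note rec = coefficient_recurrence[OF assms(2,3,6,7)]
  have power: "x powr (\<mu> * real k) = (x powr \<mu>) ^ k" if "x > 0" for x :: real and k
    using that by (simp add: powr_power mult.commute)
  have y: "y x = (\<Sum>k<Suc n. a k * x powr (\<mu> * real k))" if "x > 0" for x
    using assms(8)[OF that] by (simp only: atLeast0AtMost lessThan_Suc_atMost)
  have D1: "caputo_deriv \<mu> y x = (\<Sum>k<n. a (Suc k) * ?e (Suc k) * x powr (\<mu> * real k))"
    if "x > 0" for x
    using caputo_sum_powr_multiples(2)[OF assms(2) y that] by simp

  \<comment> \<open>For \<open>k < n\<close> strict monotonicity gives
    \<open>?e k \<noteq> ?e n\<close>, so the recurrence passes nonvanishing from \<open>a k\<close>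
    to \<open>a (Suc k)\<close>.\<close>
  have "a k \<noteq> 0" if "k \<le> n" for k
    using that
  proof (induction k)
    case (Suc k)
    then have "(?e k - ?e n) * a k \<noteq> 0"
      using caputo_factor_strict_mono[OF assms(2), of k n] by simp
    then show ?case using rec[of k] Suc.prems by force
  qed (use assms in simp)
  then have "a n \<noteq> 0" by simp
  define p where "p = (\<Sum>k<Suc n. monom (a k) k)"
  have coeff_p: "coeff p k = (if k \<le> n then a k else 0)" for k
    by (auto simp: p_def coeff_sum sum.delta simp del: sum.lessThan_Suc)
  have "degree p = n"
    using \<open>a n \<noteq> 0\<close> by (intro antisym degree_le le_degree) (auto simp: coeff_p)
  moreover have "\<forall>x>0. y x = poly p (x powr \<mu>)"
    by (auto simp: y power p_def poly_sum poly_monom simp del: sum.lessThan_Suc)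
  ultimately show "\<exists>p. degree p = n \<and> (\<forall>x>0. y x = poly p (x powr \<mu>))"
    by blast

  fix x :: real assume x: "x > 0"
  show "caputo_differentiable \<mu> y x" "caputo_differentiable \<mu> (caputo_deriv \<mu> y) x"
    using caputo_sum_powr_multiples(1)[OF assms(2) y x]
      caputo_sum_powr_multiples(1)[OF assms(2) D1 x] by blast+
  define X where "X = x powr \<mu>"
  define b where "b k = a (Suc k) * ?e (Suc k)" for k
  have Dy: "caputo_deriv \<mu> y x = (\<Sum>k<n. b k * X ^ k)"
    using D1[OF x] by (simp add: b_def power[OF x] X_def)
  \<comment> \<open>Multiplication by \<open>X\<close> shifts the index up; the added term
    \<open>k = 0\<close> is zero because \<open>?e 0 = 0\<close>.\<close>
  have XDy: "X * caputo_deriv \<mu> y x = (\<Sum>k<Suc n. ?e k * a k * X ^ k)"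
    unfolding Dy b_def sum.lessThan_Suc_shift by (simp add: sum_distrib_left mult_ac)
  have "X * (\<Sum>k<n - 1. b (Suc k) * ?e (Suc k) * X ^ k) = (\<Sum>k<n. b k * ?e k * X ^ k)"
    by (cases n) (auto simp: sum.lessThan_Suc_shift sum_distrib_left mult_ac
        simp del: sum.lessThan_Suc)
  then have XDDy: "X * (caputo_deriv \<mu> ^^ 2) y x = (\<Sum>k<n. b k * ?e k * X ^ k)"
    using caputo_sum_powr_multiples(2)[OF assms(2) D1 x] by (simp add: b_def power[OF x] X_def numeral_2_eq_2)
  have "X * (caputo_deriv \<mu> ^^ 2) y x + (\<alpha> + 1) * caputo_deriv \<mu> y x =
      (\<Sum>k<n. b k * (?e k + \<alpha> + 1) * X ^ k)"
    unfolding XDDy unfolding Dy by (simp add: sum_distrib_left sum.distrib algebra_simps)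
  also have "\<dots> = (\<Sum>k<n. (?e k - ?e n) * a k * X ^ k)"
    using rec by (intro sum.cong) (auto simp: b_def)
  \<comment> \<open>The term \<open>k = n\<close> is zero, so the sum can be extended to all
    coefficients of \<open>y\<close>: this is why the choice of \<open>?e n\<close> in the equation
    lets the solution stop at degree \<open>n\<close>.\<close>
  also have "\<dots> = (\<Sum>k<Suc n. (?e k - ?e n) * a k * X ^ k)"
    by simp
  also have "\<dots> = X * caputo_deriv \<mu> y x - ?e n * y x"
    unfolding XDy y[OF x] power[OF x] X_def[symmetric]
    by (simp add: sum_distrib_left sum_subtractf algebra_simps del: sum.lessThan_Suc)
  finally have "X * (caputo_deriv \<mu> ^^ 2) y x + (\<alpha> + 1 - X) * caputo_deriv \<mu> y x + ?e n * y x = 0"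
    by (simp add: algebra_simps)
  moreover have "Gamma \<mu> / Beta (1 + \<mu> * (real n - 1)) \<mu> = ?e n"
    using Beta_caputo_factor[OF assms(2,4)] Gamma_real_pos[OF assms(2)] by simp
  ultimately show "x powr \<mu> * (caputo_deriv \<mu> ^^ 2) y x + (\<alpha> + 1 - x powr \<mu>) * caputo_deriv \<mu> y x
      + Gamma \<mu> / Beta (1 + \<mu> * (real n - 1)) \<mu> * y x = 0"
    by (simp add: X_def)
qed

end
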